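(* Let $L>0$ and let $f:\mathbb{R}^d\to\mathbb{R}$ be convex and differentiable. Then $f$ is $L$-smooth if and only if any one of the following conditions holds (that is, each of the three conditions is individually equivalent to $L$-smoothness of $f$): (a) $\langle\nabla f(x)-\nabla f(y),x-y\rangle\ge\frac1L\|\nabla f(x)-\nabla f(y)\|^2$ for all $x,y\in\mathbb{R}^d$; (b) $f(y)\ge f(x)+\langle\nabla f(x),y-x\rangle+\frac{1}{2L}\|\nabla f(x)-\nabla f(y)\|^2$ for all $x,y\in\mathbb{R}^d$; (c) $\|\nabla f(x)-\nabla f(y)\|\le L\|x-y\|$ for all $x,y\in\mathbb{R}^d$.
   Context: $\mathbb{R}^d$ carries the dot product $\langle\cdot,\cdot\rangle$ and the induced Euclidean norm $\|\cdot\|$. For a differentiable function $h$, the Bregman distance is $D_h(x,y):=h(x)-h(y)-\langle\nabla h(y),x-y\rangle$. Let $\varphi_0=\frac12\|\cdot\|^2$. A differentiable function $f:\mathbb{R}^d\to\mathbb{R}$ is called $L$-smooth if $D_f(x,y)\le L\,D_{\varphi_0}(x,y)$ for all $x,y\in\mathbb{R}^d$. *)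

theory Defs
  imports "HOL-Analysis.Analysis"
begin

text \<open>The gradient vector, unspecified where \<open>h\<close> has no gradient. The library only provides
  the relation \<open>GDERIV h x :> D\<close>.\<close>

definition gradient :: "('a::real_inner \<Rightarrow> real) \<Rightarrow> 'a \<Rightarrow> 'a" where
  "gradient h x = (THE D. GDERIV h x :> D)"

definition bregman :: "('a::real_inner \<Rightarrow> real) \<Rightarrow> 'a \<Rightarrow> 'a \<Rightarrow> real" where
  "bregman h x y = h x - h y - gradient h y \<bullet> (x - y)"

definition phi0 :: "'a::real_inner \<Rightarrow> real" where
  "phi0 x = (norm x)\<^sup>2 / 2"

definition L_smooth :: "real \<Rightarrow> ('a::real_inner \<Rightarrow> real) \<Rightarrow> bool" where
  "L_smooth L f \<longleftrightarrow> f differentiable_on UNIV \<and> (\<forall>x y. bregman f x y \<le> L * bregman phi0 x y)"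

end

theory Submission
  imports Defs
begin

text \<open>
  The quadratic upper bound that defines \<open>L\<close>-smoothness follows from a Lipschitz gradient by
  restricting the function to a segment and comparing derivatives.
  Conversely, convexity turns the upper bound into information about the gradient. Write
  \<open>d = \<nabla>f(y) - \<nabla>f(x)\<close>. The point \<open>z = y - d / L\<close> minimises the quadratic upper bound of \<open>f\<close> at \<open>y\<close>
  minus the affine lower bound of \<open>f\<close> at \<open>x\<close>. The upper bound lies above the lower one
  at \<open>z\<close>, and this is exactly condition (b). Adding (b) to itself with \<open>x\<close> and \<open>y\<close>
  exchanged gives (a), and the Cauchy--Schwarz inequality turns (a) into (c). The equivalences
  follow from the resulting cycle: \<open>L\<close>-smoothness (\<open>convex_quadratic_bound_imp_gradient_bound\<close>)
  gives (b), then (a) (\<open>gradient_bound_imp_cocoercive\<close>), then (c)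
  (\<open>cocoercive_imp_lipschitz\<close>), then \<open>L\<close>-smoothness again (\<open>descent_lemma\<close>).
\<close>

lemma gradient_eqI:
  assumes "GDERIV h x :> D"
  shows "gradient h x = D"
  unfolding gradient_def
proof (rule the_equality)
  fix E assume "GDERIV h x :> E"
  then have "(\<lambda>v. v \<bullet> E) = (\<lambda>v. v \<bullet> D)"
    using assms unfolding gderiv_def by (rule has_derivative_unique)
  then have "(E - D) \<bullet> E = (E - D) \<bullet> D"
    by meson
  then have "(E - D) \<bullet> (E - D) = 0"
    by (simp add: inner_diff_right)
  then show "E = D"
    by simp
qed (fact assms)

text \<open>In finite dimension a linear functional is represented by the vector of its values on the
  basis, so differentiability already provides a gradient.\<close>

lemma GDERIV_gradient:
  fixes f :: "'a::euclidean_space \<Rightarrow> real"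
  assumes "f differentiable (at x)"
  shows "GDERIV f x :> gradient f x"
proof -
  obtain f' where f': "(f has_derivative f') (at x)"
    using assms unfolding differentiable_def by blast
  then have lin: "linear f'"
    by (rule has_derivative_linear)
  define D where "D = (\<Sum>b\<in>Basis. f' b *\<^sub>R b)"
  have "f' = (\<lambda>v. v \<bullet> D)"
  proof
    fix v
    have "f' v = f' (\<Sum>b\<in>Basis. (v \<bullet> b) *\<^sub>R b)"
      by (simp add: euclidean_representation)
    also have "\<dots> = v \<bullet> D"
      by (simp add: D_def linear_sum[OF lin] linear_cmul[OF lin] inner_sum_right mult.commute)
    finally show "f' v = v \<bullet> D" .
  qed
  with f' have "GDERIV f x :> D"
    by (simp add: gderiv_def)
  then show ?thesis
    using gradient_eqI by metis
qed

lemma bregman_phi0: "bregman phi0 x y = (norm (x - y))\<^sup>2 / 2"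
proof -
  have "GDERIV phi0 y :> y"
    unfolding gderiv_def phi0_def power2_norm_eq_inner
    by (auto intro!: derivative_eq_intros simp: inner_commute)
  then have "gradient phi0 y = y"
    by (rule gradient_eqI)
  then show ?thesis
    by (simp add: bregman_def phi0_def power2_norm_eq_inner inner_diff_left inner_diff_right
        inner_commute field_simps)
qed

lemma GDERIV_along_line:
  assumes "GDERIV f (y + t *\<^sub>R v) :> D"
  shows "((\<lambda>s. f (y + s *\<^sub>R v)) has_real_derivative D \<bullet> v) (at t)"
proof -
  have "((\<lambda>s. y + s *\<^sub>R v) has_derivative (\<lambda>s. s *\<^sub>R v)) (at t)"
    by (auto intro!: derivative_eq_intros)
  from has_derivative_compose[OF this assms[unfolded gderiv_def]] show ?thesis
    by (simp add: has_field_derivative_def inner_commute mult_commute_abs)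
qed

text \<open>The restriction of \<open>f\<close> to the line through \<open>x\<close> and \<open>z\<close> is convex, so the claim
  reduces to the tangent inequality for functions of one real variable.\<close>

lemma convex_above_tangent_plane:
  assumes "convex_on UNIV f" and "GDERIV f x :> D"
  shows "f z \<ge> f x + D \<bullet> (z - x)"
proof -
  let ?p = "\<lambda>t. f (x + t *\<^sub>R (z - x))"
  have "convex_on UNIV ?p"
  proof (rule convex_onI)
    fix t a b :: real assume t: "0 < t" "t < 1"
    have "x + ((1 - t) *\<^sub>R a + t *\<^sub>R b) *\<^sub>R (z - x)
        = (1 - t) *\<^sub>R (x + a *\<^sub>R (z - x)) + t *\<^sub>R (x + b *\<^sub>R (z - x))"
      by (simp add: algebra_simps)
    then show "?p ((1 - t) *\<^sub>R a + t *\<^sub>R b) \<le> (1 - t) * ?p a + t * ?p b"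
      using convex_onD[OF assms(1), of t "x + a *\<^sub>R (z - x)" "x + b *\<^sub>R (z - x)"] t by simp
  qed simp
  moreover have "(?p has_real_derivative D \<bullet> (z - x)) (at 0)"
    using assms(2) by (intro GDERIV_along_line) simp
  ultimately have "?p 1 - ?p 0 \<ge> D \<bullet> (z - x) * (1 - 0)"
    by (intro convex_on_imp_above_tangent[of UNIV]) auto
  then show ?thesis
    by simp
qed

text \<open>Along the segment from \<open>y\<close> to \<open>x\<close>, the quadratic upper bound grows at least as fast as \<open>f\<close>,
  because the Lipschitz condition controls the derivative of the difference by Cauchy--Schwarz.\<close>

lemma descent_lemma:
  assumes "\<And>x. GDERIV f x :> g x"
    and "\<And>x y. norm (g x - g y) \<le> L * norm (x - y)"
  shows "f x \<le> f y + g y \<bullet> (x - y) + L * ((norm (x - y))\<^sup>2 / 2)"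
proof -
  define v where "v = x - y"
  let ?p = "\<lambda>t. f (y + t *\<^sub>R v) - t * (g y \<bullet> v) - L / 2 * t\<^sup>2 * (norm v)\<^sup>2"
  have "?p 1 \<le> ?p 0"
  proof (rule DERIV_nonpos_imp_nonincreasing[where f = ?p])
    fix t :: real assume t: "0 \<le> t" "t \<le> 1"
    let ?d = "g (y + t *\<^sub>R v) \<bullet> v - g y \<bullet> v - L * t * (norm v)\<^sup>2"
    have "(?p has_real_derivative ?d) (at t)"
      by (auto intro!: derivative_eq_intros GDERIV_along_line assms(1))
    moreover have "?d \<le> 0"
    proof -
      have "(g (y + t *\<^sub>R v) - g y) \<bullet> v \<le> norm (g (y + t *\<^sub>R v) - g y) * norm v"
        by (rule norm_cauchy_schwarz)
      also have "\<dots> \<le> (L * norm (y + t *\<^sub>R v - y)) * norm v"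
        by (intro mult_right_mono assms(2)) simp
      also have "\<dots> = L * t * (norm v)\<^sup>2"
        using t by (simp add: power2_eq_square)
      finally show ?thesis
        by (simp add: inner_diff_left)
    qed
    ultimately show "\<exists>d. (?p has_real_derivative d) (at t) \<and> d \<le> 0"
      by blast
  qed simp
  then show ?thesis
    by (simp add: v_def)
qed

lemma convex_quadratic_bound_imp_gradient_bound:
  assumes "convex_on UNIV f" and "\<And>x. GDERIV f x :> g x" and "L > 0"
    and upper: "\<And>x y. f x \<le> f y + g y \<bullet> (x - y) + L * ((norm (x - y))\<^sup>2 / 2)"
  shows "f y \<ge> f x + g x \<bullet> (y - x) + 1 / (2 * L) * (norm (g x - g y))\<^sup>2"
proof -
  define d where "d = g y - g x"
  \<comment> \<open>The minimiser of the upper bound at \<open>y\<close> minus the lower bound at \<open>x\<close>.\<close>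
  define z where "z = y - (1 / L) *\<^sub>R d"
  have "f x + g x \<bullet> (z - x) \<le> f y + g y \<bullet> (z - y) + L * ((norm (z - y))\<^sup>2 / 2)"
    using convex_above_tangent_plane[OF assms(1,2)] upper by (rule order_trans)
  moreover have "L * ((norm (z - y))\<^sup>2 / 2) = (norm d)\<^sup>2 / (2 * L)"
    using \<open>L > 0\<close> by (simp add: z_def power2_eq_square field_simps)
  moreover have "g x \<bullet> (z - x) - g y \<bullet> (z - y) = g x \<bullet> (y - x) + (norm d)\<^sup>2 / L"
  proof -
    have "g x \<bullet> (z - x) - g y \<bullet> (z - y) = g x \<bullet> (y - x) - d \<bullet> (z - y)"
      by (simp add: d_def inner_diff_left inner_diff_right)
    then show ?thesis
      by (simp add: z_def power2_norm_eq_inner)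
  qed
  moreover have "(norm d)\<^sup>2 / L = 2 * ((norm d)\<^sup>2 / (2 * L))"
    by simp
  ultimately have "f x + g x \<bullet> (y - x) + (norm d)\<^sup>2 / (2 * L) \<le> f y"
    by linarith
  then show ?thesis
    by (simp add: d_def norm_minus_commute)
qed

lemma gradient_bound_imp_cocoercive:
  fixes g :: "'a::real_inner \<Rightarrow> 'a" and f :: "'a \<Rightarrow> real"
  assumes "\<And>x y. f y \<ge> f x + g x \<bullet> (y - x) + 1 / (2 * L) * (norm (g x - g y))\<^sup>2"
  shows "(g x - g y) \<bullet> (x - y) \<ge> 1 / L * (norm (g x - g y))\<^sup>2"
proof -
  have "g x \<bullet> (y - x) + g y \<bullet> (x - y) + 2 * (1 / (2 * L) * (norm (g x - g y))\<^sup>2) \<le> 0"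
    using assms[of x y] assms[of y x] by (simp add: norm_minus_commute)
  moreover have "g x \<bullet> (y - x) + g y \<bullet> (x - y) = - ((g x - g y) \<bullet> (x - y))"
    by (simp add: inner_diff_left inner_diff_right)
  ultimately show ?thesis
    by simp
qed

lemma cocoercive_imp_lipschitz:
  fixes x y a b :: "'a::real_inner"
  assumes "L > 0" and "(a - b) \<bullet> (x - y) \<ge> 1 / L * (norm (a - b))\<^sup>2"
  shows "norm (a - b) \<le> L * norm (x - y)"
proof (cases "a = b")
  case False
  have "1 / L * (norm (a - b))\<^sup>2 \<le> norm (a - b) * norm (x - y)"
    using assms(2) norm_cauchy_schwarz by (rule order_trans)
  then have "norm (a - b) * norm (a - b) \<le> norm (a - b) * (L * norm (x - y))"
    using \<open>L > 0\<close> by (simp add: power2_eq_square field_simps)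
  then show ?thesis
    using False by simp
qed (use \<open>L > 0\<close> in simp)

theorem corollary3p1:
  fixes f :: "real ^ 'd \<Rightarrow> real" and L :: real
  assumes "L > 0"
    and "convex_on UNIV f"
    and "f differentiable_on UNIV"
  shows "(L_smooth L f \<longleftrightarrow>
           (\<forall>x y. (gradient f x - gradient f y) \<bullet> (x - y)
                  \<ge> 1 / L * (norm (gradient f x - gradient f y))\<^sup>2)) \<and>
         (L_smooth L f \<longleftrightarrow>
           (\<forall>x y. f y \<ge> f x + gradient f x \<bullet> (y - x)
                        + 1 / (2 * L) * (norm (gradient f x - gradient f y))\<^sup>2)) \<and>
         (L_smooth L f \<longleftrightarrow>
           (\<forall>x y. norm (gradient f x - gradient f y) \<le> L * norm (x - y)))"
proof -
  let ?g = "gradient f"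
  let ?a = "\<forall>x y. (?g x - ?g y) \<bullet> (x - y) \<ge> 1 / L * (norm (?g x - ?g y))\<^sup>2"
  let ?b = "\<forall>x y. f y \<ge> f x + ?g x \<bullet> (y - x) + 1 / (2 * L) * (norm (?g x - ?g y))\<^sup>2"
  let ?c = "\<forall>x y. norm (?g x - ?g y) \<le> L * norm (x - y)"
  have g: "GDERIV f x :> ?g x" for x
    using assms(3) by (intro GDERIV_gradient) (simp add: differentiable_on_def)
  have smooth: "L_smooth L f \<longleftrightarrow>
      (\<forall>x y. f x \<le> f y + ?g y \<bullet> (x - y) + L * ((norm (x - y))\<^sup>2 / 2))"
    using assms(3) by (simp add: L_smooth_def bregman_phi0 bregman_def[of f] field_simps)
  have "L_smooth L f \<Longrightarrow> ?b"
    using convex_quadratic_bound_imp_gradient_bound[OF assms(2) g assms(1)]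
    unfolding smooth by blast
  moreover have "?b \<Longrightarrow> ?a"
    using gradient_bound_imp_cocoercive[of f ?g L] by blast
  moreover have "?a \<Longrightarrow> ?c"
    using cocoercive_imp_lipschitz[OF assms(1)] by blast
  moreover have "?c \<Longrightarrow> L_smooth L f"
    using descent_lemma[OF g] unfolding smooth by blast
  ultimately show ?thesis
    by argo
qed

end
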